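(* Let $X$ be the graph of a strictly convex function $g:I\to\mathbb{R}$ ($I$ an open interval) in the $uv$-plane $\mathbb{R}^2$, with upward unit normal $N$. For a point $P=(u,g(u))$ on $X$ and sufficiently small $h>0$, let $l$ be the line through $P+hN(P)$ parallel to the tangent $t$ of $X$ at $P$, and let $V$ be the point where the line through $P$ parallel to the $v$-axis meets $l$. Then $X$ is an open part of a parabola with axis parallel to the $v$-axis if and only if it satisfies the following condition: For each point $P$ on $X$ and every sufficiently small $h>0$, the center of gravity $G$ of the section of $X$ cut off by $l$ lies on the segment $PV$, with $$PG=\frac{3}{5}PV,$$ where $PG$ and $PV$ in this equality denote lengths of segments.
   Context: A function $g:I\to\mathbb{R}$ on an open interval is called strictly convex here if it is of class $C^{3}$ and its graph has positive curvature with respect to the upward unit normal $N$; equivalently $g''>0$ on $I$. For a point $P$ on $X$ and sufficiently small $h>0$ (how small may depend on $P$), the line $l$ through $P+hN(P)$ parallel to the tangent at $P$ meets $X$ near $P$ in two points $A,B$, one on each side of $P$ along the curve. The section of $X$ cut off by $l$ is the bounded planar region enclosed by the arc of $X$ from $A$ to $B$ through $P$ and the chord $AB$. Its center of gravity is its centroid (with uniform density). "An open part of a parabola" means a connected relatively open subset of a parabola. *)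

theory Defs
  imports "HOL-Analysis.Analysis"
begin

type_synonym plane = "real \<times> real"

definition strictly_convex_C3 :: "(real \<Rightarrow> real) \<Rightarrow> real set \<Rightarrow> bool" where
  "strictly_convex_C3 g I \<longleftrightarrow>
     (\<forall>k<3. (deriv ^^ k) g differentiable_on I) \<and>
     continuous_on I ((deriv ^^ 3) g) \<and>
     (\<forall>x\<in>I. (deriv ^^ 2) g x > 0)"

definition graph_point :: "(real \<Rightarrow> real) \<Rightarrow> real \<Rightarrow> plane" where
  "graph_point g u = (u, g u)"

definition graph_on :: "(real \<Rightarrow> real) \<Rightarrow> real set \<Rightarrow> plane set" where
  "graph_on g I = graph_point g ` I"

definition line_through :: "plane \<Rightarrow> plane \<Rightarrow> plane set" where
  "line_through Q d = {Q + t *\<^sub>R d | t. True}"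

definition upward_normal :: "(real \<Rightarrow> real) \<Rightarrow> real \<Rightarrow> plane" where
  "upward_normal g u = (1 / sqrt (1 + (deriv g u)\<^sup>2)) *\<^sub>R (- deriv g u, 1)"

definition cutting_line :: "(real \<Rightarrow> real) \<Rightarrow> real \<Rightarrow> real \<Rightarrow> plane set" where
  "cutting_line g u h =
     line_through (graph_point g u + h *\<^sub>R upward_normal g u) (1, deriv g u)"

(* A and B are given by their abscissae a < u < b. A strictly convex graph meets the
   cutting line in at most one point on each side of u, so no further localisation
   near u is needed to determine them. *)
definition cut_abscissae ::
  "(real \<Rightarrow> real) \<Rightarrow> real set \<Rightarrow> real \<Rightarrow> real \<Rightarrow> real \<Rightarrow> real \<Rightarrow> bool" where
  "cut_abscissae g I u h a b \<longleftrightarrow>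
     a \<in> I \<and> b \<in> I \<and> a < u \<and> u < b \<and>
     graph_point g a \<in> cutting_line g u h \<and> graph_point g b \<in> cutting_line g u h"

(* "inside" is the union of the bounded components of the complement, so this is the
   open region; its boundary is a null set and does not affect the centroid. *)
definition cut_section :: "(real \<Rightarrow> real) \<Rightarrow> real \<Rightarrow> real \<Rightarrow> plane set" where
  "cut_section g a b =
     inside (graph_on g {a..b} \<union> closed_segment (graph_point g a) (graph_point g b))"

definition centroid :: "plane set \<Rightarrow> plane" where
  "centroid S = (1 / measure lborel S) *\<^sub>R (LINT p:S|lborel. p)"

definition parabola :: "plane \<Rightarrow> plane set \<Rightarrow> plane set" where
  "parabola F L = {p. dist p F = infdist p L}"

definition parabola_with_axis :: "plane set \<Rightarrow> plane set \<Rightarrow> bool" where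
  "parabola_with_axis C A \<longleftrightarrow>
     (\<exists>F Q d n. d \<noteq> 0 \<and> n \<noteq> 0 \<and> d \<bullet> n = 0 \<and> F \<notin> line_through Q d \<and>
        C = parabola F (line_through Q d) \<and> A = line_through F n)"

definition open_part_of :: "plane set \<Rightarrow> plane set \<Rightarrow> bool" where
  "open_part_of X C \<longleftrightarrow> openin (top_of_set C) X \<and> connected X"

end

theory Submission
  imports Defs
begin

text \<open>The section at \<open>P = (u, g u)\<close> is the set of points between the graph and the chord over
  an interval \<open>(a, b)\<close>. Write \<open>f\<close> for the difference of \<open>g\<close> and its tangent at \<open>u\<close>, so
  that the chord lies over \<open>f = H\<close>. By Fubini, the centroid has abscissa \<open>u\<close> iff the moment
  \<open>\<integral>\<^sub>a\<^sup>b (x - u) (H - f x) dx\<close> vanishes, and this condition alone already forces a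
  parabola: if \<open>g''' u\<close> were positive, then \<open>f (u + t) > f (u - t)\<close> for all small
  \<open>t > 0\<close>, and the moment would be negative for all small \<open>h\<close>; the negative case is
  symmetric. Hence \<open>g''' = 0\<close> and \<open>g\<close> is quadratic. Conversely, for a quadratic \<open>g\<close> with
  leading coefficient \<open>c\<close> one has \<open>a, b = u \<plusminus> r\<close> with \<open>H = c r\<^sup>2\<close>, and the centroid is an
  explicit polynomial integral.\<close>

section \<open>Signs of first moments and of odd parts\<close>

text \<open>Fold the integral at 0, pairing \<open>t\<close> with \<open>-t\<close>. On
  \<open>{0..\<beta>}\<close> the weight at \<open>-t\<close> strictly dominates the weight at
  \<open>t\<close>; the part of the left half beyond \<open>\<beta>\<close> has no partner and
  contributes with a negative sign as well. In the application \<open>k t\<close> is the vertical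
  distance from the graph up to the chord at \<open>u + t\<close>.\<close>

lemma first_moment_neg:
  fixes k :: "real \<Rightarrow> real"
  assumes "0 < \<alpha>" "0 < \<beta>" and cont: "continuous_on {-\<alpha>..\<beta>} k"
    and nonneg: "\<And>t. t \<in> {-\<alpha>..\<beta>} \<Longrightarrow> 0 \<le> k t"
    and "k (-\<alpha>) = 0"
    and asym: "\<And>t. 0 < t \<Longrightarrow> t \<le> \<alpha> \<Longrightarrow> t \<le> \<beta> \<Longrightarrow> k t < k (-t)"
  shows "integral {-\<alpha>..\<beta>} (\<lambda>t. t * k t) < 0"
proof -
  \<comment> \<open>If \<open>\<alpha> \<le> \<beta>\<close>, then \<open>asym\<close> at
    \<open>t = \<alpha>\<close> would give \<open>k \<alpha> < k (-\<alpha>) = 0\<close>, against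
    nonnegativity.\<close>
  have "\<beta> < \<alpha>"
    using asym[of \<alpha>] nonneg[of \<alpha>] \<open>k (-\<alpha>) = 0\<close> \<open>0 < \<alpha>\<close> by fastforce
  have cont': "continuous_on {-\<alpha>..\<beta>} (\<lambda>t. t * k t)"
    by (intro continuous_intros cont)
  have refl: "continuous_on {-\<beta>..\<alpha>} (\<lambda>t. k (- t))"
    by (rule continuous_on_compose2[OF cont]) (auto intro!: continuous_intros)
  have "integral {-\<alpha>..\<beta>} (\<lambda>t. t * k t)
      = integral {-\<alpha>..0} (\<lambda>t. t * k t) + integral {0..\<beta>} (\<lambda>t. t * k t)"
    using assms(1,2) by (subst Henstock_Kurzweil_Integration.integral_combine)
      (auto intro!: integrable_continuous_real cont')
  also have "integral {-\<alpha>..0} (\<lambda>t. t * k t) = integral {0..\<alpha>} (\<lambda>t. - t * k (- t))"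
    using Henstock_Kurzweil_Integration.integral_reflect_real[of 0 "-\<alpha>" "\<lambda>t. t * k t"] by simp
  also have "\<dots> = - integral {0..\<alpha>} (\<lambda>t. t * k (- t))"
    by simp
  also have "integral {0..\<alpha>} (\<lambda>t. t * k (- t))
      = integral {0..\<beta>} (\<lambda>t. t * k (- t)) + integral {\<beta>..\<alpha>} (\<lambda>t. t * k (- t))"
    using assms(1,2) \<open>\<beta> < \<alpha>\<close>
    by (subst Henstock_Kurzweil_Integration.integral_combine)
      (auto intro!: integrable_continuous_real continuous_intros continuous_on_subset[OF refl])
  finally have eq: "integral {-\<alpha>..\<beta>} (\<lambda>t. t * k t) = integral {0..\<beta>} (\<lambda>t. t * k t)
      - integral {0..\<beta>} (\<lambda>t. t * k (- t)) - integral {\<beta>..\<alpha>} (\<lambda>t. t * k (- t))"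
    by simp
  have "integral {0..\<beta>} (\<lambda>t. t * k t) < integral {0..\<beta>} (\<lambda>t. t * k (- t))"
    using assms(1,2) \<open>\<beta> < \<alpha>\<close>
    by (intro integral_less_real)
      (auto intro!: continuous_intros continuous_on_subset[OF cont] continuous_on_subset[OF refl]
        asym)
  moreover have "0 \<le> integral {\<beta>..\<alpha>} (\<lambda>t. t * k (- t))"
    using assms(1,2) \<open>\<beta> < \<alpha>\<close> by (intro integral_nonneg)
      (auto intro!: integrable_continuous_real continuous_intros continuous_on_subset[OF refl]
        mult_nonneg_nonneg nonneg)
  ultimately show ?thesis
    using eq by simp
qed

text \<open>The mirror image under \<open>t \<mapsto> -t\<close>: the roles of
  \<open>\<alpha>\<close> and \<open>\<beta>\<close> are exchanged, so the end where
  \<open>k\<close> vanishes is now \<open>\<beta>\<close>.\<close>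

lemma first_moment_pos:
  fixes k :: "real \<Rightarrow> real"
  assumes "0 < \<alpha>" "0 < \<beta>" and cont: "continuous_on {-\<alpha>..\<beta>} k"
    and "\<And>t. t \<in> {-\<alpha>..\<beta>} \<Longrightarrow> 0 \<le> k t"
    and "k \<beta> = 0"
    and "\<And>t. 0 < t \<Longrightarrow> t \<le> \<alpha> \<Longrightarrow> t \<le> \<beta> \<Longrightarrow> k (-t) < k t"
  shows "0 < integral {-\<alpha>..\<beta>} (\<lambda>t. t * k t)"
proof -
  have "integral {-\<beta>..\<alpha>} (\<lambda>t. t * k (- t)) < 0"
    using assms
    by (intro first_moment_neg)
      (auto intro!: continuous_on_compose2[OF cont] continuous_intros)
  moreover have "integral {-\<beta>..\<alpha>} (\<lambda>t. - t * k (- t)) = integral {-\<alpha>..\<beta>} (\<lambda>t. t * k t)"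
    using Henstock_Kurzweil_Integration.integral_reflect_real[of \<beta> "-\<alpha>" "\<lambda>t. t * k t"] by simp
  ultimately show ?thesis
    by simp
qed

text \<open>The second derivative of the odd part \<open>F (u + t) - F (u - t)\<close> is
  \<open>F2 (u + t) - F2 (u - t)\<close>, whose sign for small \<open>t\<close> is that of \<open>D\<close>; third
  derivatives away from \<open>u\<close> do not enter.\<close>

lemma odd_part_gt_tangent:
  fixes F F1 F2 :: "real \<Rightarrow> real"
  assumes "open I" "u \<in> I"
    and F: "\<And>x. x \<in> I \<Longrightarrow> (F has_real_derivative F1 x) (at x)"
    and F1: "\<And>x. x \<in> I \<Longrightarrow> (F1 has_real_derivative F2 x) (at x)"
    and F2: "(F2 has_real_derivative D) (at u)" and "0 < D"
  shows "\<exists>\<delta>>0. \<forall>t. 0 < t \<longrightarrow> t < \<delta> \<longrightarrow> 2 * F1 u * t < F (u + t) - F (u - t)"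
proof -
  obtain d1 where d1: "d1 > 0" "\<And>h. h > 0 \<Longrightarrow> h < d1 \<Longrightarrow> F2 u < F2 (u + h)"
    using DERIV_pos_inc_right[OF F2 \<open>0 < D\<close>] by blast
  obtain d2 where d2: "d2 > 0" "\<And>h. h > 0 \<Longrightarrow> h < d2 \<Longrightarrow> F2 (u - h) < F2 u"
    using DERIV_pos_inc_left[OF F2 \<open>0 < D\<close>] by blast
  obtain d3 where d3: "d3 > 0" "ball u d3 \<subseteq> I"
    using assms(1,2) open_contains_ball by blast
  define \<delta> where "\<delta> = min d1 (min d2 d3)"
  have inI: "u + t \<in> I" "u - t \<in> I" if "0 \<le> t" "t < \<delta>" for t
    using that d3 by (auto simp: \<delta>_def dist_real_def)
  define k1 where "k1 t = F1 (u + t) + F1 (u - t) - 2 * F1 u" for t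
  define k where "k t = F (u + t) - F (u - t) - 2 * F1 u * t" for t
  have dk: "(k has_real_derivative k1 t) (at t)" if "0 \<le> t" "t < \<delta>" for t
    unfolding k_def k1_def
    by (auto intro!: derivative_eq_intros DERIV_chain2[OF F] inI that)
  have dk1: "(k1 has_real_derivative (F2 (u + t) - F2 (u - t))) (at t)" if "0 \<le> t" "t < \<delta>" for t
    unfolding k1_def
    by (auto intro!: derivative_eq_intros DERIV_chain2[OF F1] inI that)
  have k1_pos: "0 < k1 t" if "0 < t" "t < \<delta>" for t
  proof -
    \<comment> \<open>Here \<open>k1 0 = 0\<close>, and \<open>d1\<close>, \<open>d2\<close> give
      \<open>F2 (u - s) < F2 u < F2 (u + s)\<close>. The criterion for open intervals is used
      because the derivative of \<open>k1\<close> vanishes at \<open>s = 0\<close>; the same happens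
      for \<open>k\<close> below.\<close>
    have "k1 0 < k1 t"
    proof (rule DERIV_pos_imp_increasing_open[OF \<open>0 < t\<close>])
      fix s assume "0 < s" "s < t"
      then show "\<exists>y. (k1 has_real_derivative y) (at s) \<and> 0 < y"
        using dk1[of s] d1(2)[of s] d2(2)[of s] that
        by (intro exI[of _ "F2 (u + s) - F2 (u - s)"]) (auto simp: \<delta>_def)
    next
      show "continuous_on {0..t} k1"
        using that by (intro continuous_at_imp_continuous_on) (auto intro!: DERIV_isCont[OF dk1])
    qed
    then show ?thesis
      by (simp add: k1_def)
  qed
  have "0 < k t" if "0 < t" "t < \<delta>" for t
  proof -
    have "k 0 < k t"
    proof (rule DERIV_pos_imp_increasing_open[OF \<open>0 < t\<close>])
      fix s assume "0 < s" "s < t"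
      then show "\<exists>y. (k has_real_derivative y) (at s) \<and> 0 < y"
        using dk[of s] k1_pos[of s] that by (intro exI[of _ "k1 s"]) auto
    next
      show "continuous_on {0..t} k"
        using that by (intro continuous_at_imp_continuous_on) (auto intro!: DERIV_isCont[OF dk])
    qed
    then show ?thesis
      by (simp add: k_def)
  qed
  moreover have "\<delta> > 0"
    using d1 d2 d3 by (simp add: \<delta>_def)
  ultimately show ?thesis
    by (intro exI[of _ \<delta>]) (auto simp: k_def)
qed

section \<open>Regions between two graphs: topology, integration, centroid\<close>

lemma mem_graph_on_iff: "(x, y) \<in> graph_on f S \<longleftrightarrow> x \<in> S \<and> y = f x"
  by (auto simp: graph_on_def graph_point_def)

text \<open>Turns the chord into a graph over the same interval as the arc, so that the boundary of
  a section consists of two graphs.\<close>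

lemma graph_on_affine_eq_closed_segment:
  assumes "a \<le> b"
  shows "graph_on (\<lambda>x. p + k * x) {a..b} = closed_segment (a, p + k * a) (b, p + k * b)"
proof -
  have "closed_segment (a, p + k * a) (b, p + k * b) = (\<lambda>x. (x, p + k * x)) ` closed_segment a b"
    unfolding closed_segment_image_interval image_image
    by (intro image_cong) (auto simp: algebra_simps)
  then show ?thesis
    using assms by (simp add: graph_on_def graph_point_def closed_segment_eq_real_ivl)
qed

text \<open>All inequalities are strict, so that the set equals the \<open>inside\<close> of its
  boundary curve exactly and not just up to a null set.\<close>

definition region_between ::
  "(real \<Rightarrow> real) \<Rightarrow> (real \<Rightarrow> real) \<Rightarrow> real \<Rightarrow> real \<Rightarrow> plane set" where
  "region_between g L a b = {(x, y). a < x \<and> x < b \<and> g x < y \<and> y < L x}"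

context
  fixes g L :: "real \<Rightarrow> real" and a b :: real
  assumes contg: "continuous_on {a..b} g" and contL: "continuous_on {a..b} L"
begin

lemma open_region_between: "open (region_between g L a b)"
proof -
  \<comment> \<open>Continuity of \<open>g\<close> and \<open>L\<close> is available over
    \<open>{a..b}\<close> only, so openness is obtained within the open strip over
    \<open>{a<..<b}\<close>.\<close>
  have "continuous_on ({a<..<b} \<times> UNIV) (\<lambda>p. (snd p - g (fst p)) :: real)"
    "continuous_on ({a<..<b} \<times> UNIV) (\<lambda>p. (L (fst p) - snd p) :: real)"
    by (intro continuous_intros continuous_on_compose2[OF contg]
      continuous_on_compose2[OF contL]; auto)+
  then have "open (({a<..<b} \<times> UNIV) \<inter> (\<lambda>p. (snd p - g (fst p)) :: real) -` {0<..})"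
    "open (({a<..<b} \<times> UNIV) \<inter> (\<lambda>p. (L (fst p) - snd p) :: real) -` {0<..})"
    by (auto intro!: continuous_open_preimage open_Times)
  note open_Int[OF this]
  also have "(({a<..<b} \<times> UNIV) \<inter> (\<lambda>p. snd p - g (fst p)) -` {0<..}) \<inter>
      (({a<..<b} \<times> UNIV) \<inter> (\<lambda>p. L (fst p) - snd p) -` {0<..}) = region_between g L a b"
    by (auto simp: region_between_def)
  finally show ?thesis .
qed

text \<open>This compact set contains the open region and its closure. It thereby bounds the region,
  locates its frontier, and makes continuous functions integrable on it.\<close>

lemma compact_closed_region_between:
  "compact {p. fst p \<in> {a..b} \<and> g (fst p) \<le> snd p \<and> snd p \<le> L (fst p)}" (is "compact ?K")
proof -
  obtain B where B: "\<And>x. x \<in> {a..b} \<Longrightarrow> \<bar>g x\<bar> \<le> B"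
    using compact_imp_bounded[OF compact_continuous_image[OF contg compact_Icc]]
    unfolding bounded_iff by fastforce
  obtain C where C: "\<And>x. x \<in> {a..b} \<Longrightarrow> \<bar>L x\<bar> \<le> C"
    using compact_imp_bounded[OF compact_continuous_image[OF contL compact_Icc]]
    unfolding bounded_iff by fastforce
  have "closed (({a..b} \<times> {-B..C}) \<inter> (\<lambda>p. snd p - g (fst p)) -` {0..})"
    "closed (({a..b} \<times> {-B..C}) \<inter> (\<lambda>p. L (fst p) - snd p) -` {0..})"
    by (intro continuous_closed_preimage continuous_intros continuous_on_compose2[OF contg]
      continuous_on_compose2[OF contL] closed_Times; auto)+
  note closed_Int[OF this]
  also have "(({a..b} \<times> {-B..C}) \<inter> (\<lambda>p. snd p - g (fst p)) -` {0..}) \<inter>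
      (({a..b} \<times> {-B..C}) \<inter> (\<lambda>p. L (fst p) - snd p) -` {0..}) = ?K"
    using B C by (fastforce simp: abs_le_iff)
  finally have "closed ?K" .
  moreover have "?K \<subseteq> {a..b} \<times> {-B..C}"
    using B C by (fastforce simp: abs_le_iff)
  then have "bounded ?K"
    by (rule bounded_subset[rotated]) (simp add: bounded_Times)
  ultimately show ?thesis
    by (simp add: compact_eq_bounded_closed)
qed

text \<open>The complement of the region and of the curve is swept out by vertical rays avoiding the
  curve, hence unbounded; conversely the frontier of the region lies on the curve.\<close>

lemma inside_two_graphs:
  assumes "a < b" "g a = L a" "g b = L b" and less: "\<And>x. a < x \<Longrightarrow> x < b \<Longrightarrow> g x < L x"
  shows "inside (graph_on g {a..b} \<union> graph_on L {a..b}) = region_between g L a b"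
    (is "inside ?S = ?R")
proof (intro equalityI subsetI)
  define K where "K = {p. fst p \<in> {a..b} \<and> g (fst p) \<le> snd p \<and> snd p \<le> L (fst p)}"
  have "compact K"
    unfolding K_def by (rule compact_closed_region_between)
  have RK: "?R \<subseteq> K"
    by (auto simp: region_between_def K_def)
  have mem_S: "(x, y) \<in> ?S \<longleftrightarrow> x \<in> {a..b} \<and> (y = g x \<or> y = L x)" for x y
    by (auto simp: mem_graph_on_iff)
  have "closure ?R \<subseteq> K"
    using RK \<open>compact K\<close> by (simp add: closure_minimal compact_imp_closed)
  \<comment> \<open>Over \<open>a\<close> and \<open>b\<close> the two graphs meet, so the vertical
    sides of \<open>K\<close> degenerate to points of the curve.\<close>
  have KR: "K - ?R \<subseteq> ?S"
  proof
    fix p assume p: "p \<in> K - ?R"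
    obtain x y where xy: "p = (x, y)"
      by fastforce
    show "p \<in> ?S"
      using p assms(2,3) unfolding xy mem_S
      by (cases "x = a"; cases "x = b") (auto simp: K_def region_between_def)
  qed
  have frontier: "frontier ?R \<subseteq> ?S"
    using KR \<open>closure ?R \<subseteq> K\<close> open_region_between by (auto simp: frontier_def interior_open)
  have R_S: "?R \<inter> ?S = {}"
    unfolding disjoint_iff split_paired_All mem_S by (auto simp: region_between_def)
  show "p \<in> inside ?S" if "p \<in> ?R" for p
  proof -
    let ?C = "connected_component_set (- ?S) p"
    have "p \<in> ?C"
      using that R_S by (auto simp: connected_component_refl_eq)
    moreover have "?C \<inter> frontier ?R = {}"
      using frontier connected_component_subset[of "- ?S" p] by auto
    \<comment> \<open>A connected set that meets \<open>?R\<close> and misses its frontier stays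
      inside \<open>?R\<close>.\<close>
    ultimately have "?C \<subseteq> ?R"
      using connected_Int_frontier[of ?C ?R] that connected_connected_component[of "- ?S" p] by blast
    moreover have "bounded ?R"
      using RK \<open>compact K\<close> bounded_subset compact_imp_bounded by blast
    ultimately show ?thesis
      using that R_S bounded_subset by (auto simp: inside_def)
  qed
  show "p \<in> ?R" if "p \<in> inside ?S" for p
  proof (rule ccontr)
    obtain x y where xy: "p = (x, y)"
      by fastforce
    assume "p \<notin> ?R"
    have "p \<notin> ?S" and bdd: "bounded (connected_component_set (- ?S) p)"
      using that by (auto simp: inside_def)
    \<comment> \<open>The ray goes down from a point below the graph of \<open>g\<close>. In all
      other cases it goes up: the point lies above \<open>L\<close> or outside the strip over
      \<open>{a..b}\<close>.\<close>
    have "\<exists>s::real. s \<noteq> 0 \<and> (\<forall>t\<ge>0. (x, y + t * s) \<notin> ?S)"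
    proof (cases "x \<in> {a..b} \<and> y < g x")
      case True
      then have "g x \<le> L x"
        using assms less by (metis atLeastAtMost_iff le_less order_refl)
      then show ?thesis
        using True by (intro exI[of _ "-1"]) (auto simp: mem_graph_on_iff)
    next
      case False
      have "x \<in> {a..b} \<Longrightarrow> g x \<le> L x"
        using assms less by (metis atLeastAtMost_iff le_less order_refl)
      moreover have "x \<in> {a..b} \<Longrightarrow> L x < y"
        using False \<open>p \<notin> ?R\<close> \<open>p \<notin> ?S\<close> assms(2,3) unfolding xy mem_S
        by (cases "x = a"; cases "x = b") (auto simp: region_between_def)
      ultimately show ?thesis
        by (intro exI[of _ "1"]) (auto simp: mem_graph_on_iff)
    qed
    then obtain s :: real where s: "s \<noteq> 0" "\<And>t. t \<ge> 0 \<Longrightarrow> (x, y + t * s) \<notin> ?S"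
      by blast
    let ?T = "(\<lambda>t. (x, y + t * s)) ` {0..}"
    have "connected ?T"
      by (intro connected_continuous_image continuous_intros) auto
    moreover have "p \<in> ?T"
      unfolding xy by (rule image_eqI[of _ _ 0]) auto
    ultimately have "?T \<subseteq> connected_component_set (- ?S) p"
      using s(2) by (intro connected_component_maximal) auto
    then have "bounded (snd ` ?T)"
      using bdd bounded_subset bounded_snd by blast
    then obtain B where B: "\<And>t. t \<ge> 0 \<Longrightarrow> \<bar>y + t * s\<bar> \<le> B"
      by (force simp: bounded_iff)
    \<comment> \<open>Far enough along the ray that \<open>\<bar>t * s\<bar>\<close> exceeds
      \<open>\<bar>y\<bar> + B\<close>, which contradicts the bound \<open>B\<close> on the
      ordinates.\<close>
    define t where "t = (\<bar>y\<bar> + B + 1) / \<bar>s\<bar>"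
    have "B \<ge> 0"
      using B[of 0] by simp
    then have "t \<ge> 0"
      by (simp add: t_def)
    have "\<bar>t * s\<bar> = \<bar>y\<bar> + B + 1"
      using s(1) \<open>B \<ge> 0\<close> by (simp add: t_def abs_mult)
    then show False
      using B[OF \<open>t \<ge> 0\<close>] by linarith
  qed
qed

lemma region_between_integrable:
  fixes \<phi> :: "plane \<Rightarrow> 'c::{banach, second_countable_topology}"
  assumes "continuous_on UNIV \<phi>"
  shows "set_integrable lborel (region_between g L a b) \<phi>"
proof (rule set_integrable_subset)
  show "set_integrable lborel {p. fst p \<in> {a..b} \<and> g (fst p) \<le> snd p \<and> snd p \<le> L (fst p)} \<phi>"
    unfolding set_integrable_def
    by (intro borel_integrable_compact compact_closed_region_between
      continuous_on_subset[OF assms]) auto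
  show "region_between g L a b \<in> sets lborel"
    using open_region_between by simp
qed (auto simp: region_between_def)

text \<open>Fubini, with the integral along each vertical line supplied as \<open>\<Phi>\<close>.
  Area and both moments are the instances with integrand 1, \<open>fst\<close> and
  \<open>snd\<close>.\<close>

lemma region_between_integral:
  fixes \<phi> :: "plane \<Rightarrow> real"
  assumes "continuous_on UNIV \<phi>" and \<Phi>: "continuous_on {a..b} \<Phi>"
    and inner: "\<And>x. a < x \<Longrightarrow> x < b \<Longrightarrow> ((\<lambda>y. \<phi> (x, y)) has_integral \<Phi> x) {g x..L x}"
  shows "(LINT p:region_between g L a b|lborel. \<phi> p) = integral {a..b} \<Phi>"
proof -
  let ?R = "region_between g L a b"
  have int: "integrable (lborel \<Otimes>\<^sub>M lborel) (\<lambda>p. indicator ?R p *\<^sub>R \<phi> p)"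
    using region_between_integrable[OF assms(1)] by (simp add: set_integrable_def lborel_prod)
  \<comment> \<open>The vertical section over \<open>x\<close> is the open interval from
    \<open>g x\<close> to \<open>L x\<close>; its end points do not change the integral, which is
    why \<open>inner\<close> may be stated on the closed interval.\<close>
  have inner_eq: "(LINT y|lborel. indicator ?R (x, y) *\<^sub>R \<phi> (x, y))
      = indicator {a<..<b} x *\<^sub>R \<Phi> x" for x
  proof (cases "a < x \<and> x < b")
    case True
    have c: "continuous_on A (\<lambda>y. \<phi> (x, y))" for A
      by (intro continuous_on_compose2[OF assms(1)] continuous_intros) auto
    have "(LINT y|lborel. indicator ?R (x, y) *\<^sub>R \<phi> (x, y))
        = (LINT y:{g x<..<L x}|lborel. \<phi> (x, y))"
      unfolding set_lebesgue_integral_def using True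
      by (intro Bochner_Integration.integral_cong) (auto simp: region_between_def indicator_def)
    also have "\<dots> = integral {g x<..<L x} (\<lambda>y. \<phi> (x, y))"
      by (intro set_borel_integral_eq_integral(2)
        set_integrable_subset[OF borel_integrable_atLeastAtMost'[OF c, of "g x" "L x"]]) auto
    also have "\<dots> = \<Phi> x"
      using inner[of x] True by (metis integral_open_interval_real integral_unique)
    finally show ?thesis
      using True by simp
  qed (auto simp: region_between_def indicator_def)
  have "(LINT p:?R|lborel. \<phi> p)
      = (LINT x|lborel. LINT y|lborel. indicator ?R (x, y) *\<^sub>R \<phi> (x, y))"
    unfolding set_lebesgue_integral_def
    by (subst lborel_pair.integral_fst'[OF int]) (simp add: lborel_prod)
  also have "\<dots> = (LINT x:{a<..<b}|lborel. \<Phi> x)"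
    by (simp only: inner_eq set_lebesgue_integral_def)
  also have "\<dots> = integral {a<..<b} \<Phi>"
    by (intro set_borel_integral_eq_integral(2)
      set_integrable_subset[OF borel_integrable_atLeastAtMost'[OF \<Phi>]]) auto
  finally show ?thesis
    by (simp add: integral_open_interval_real)
qed

lemma centroid_region_between:
  assumes le: "\<And>x. a < x \<Longrightarrow> x < b \<Longrightarrow> g x \<le> L x"
  defines "A \<equiv> integral {a..b} (\<lambda>x. L x - g x)"
  shows "centroid (region_between g L a b) =
    (integral {a..b} (\<lambda>x. x * (L x - g x)) / A,
     integral {a..b} (\<lambda>x. ((L x)\<^sup>2 - (g x)\<^sup>2) / 2) / A)"
proof -
  let ?R = "region_between g L a b"
  have "measure lborel ?R = (LINT p:?R|lborel. 1)"
    using open_region_between by (simp add: set_lebesgue_integral_def)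
  also have "\<dots> = A"
    unfolding A_def
  proof (intro region_between_integral continuous_intros contg contL)
    fix x assume "a < x" "x < b"
    then show "((\<lambda>y. 1) has_integral L x - g x) {g x..L x}"
      using has_integral_const_real[of "1::real" "g x" "L x"] le[of x] by simp
  qed
  finally have area: "measure lborel ?R = A" .
  have int: "integrable lborel (\<lambda>p. indicator ?R p *\<^sub>R p)"
    using region_between_integrable[of "\<lambda>p. p"] by (simp add: set_integrable_def)
  \<comment> \<open>The centroid uses a vector-valued integral; a coordinate projection commutes
    with it, being bounded and linear.\<close>
  have "fst (LINT p:?R|lborel. p) = (LINT p:?R|lborel. fst p)"
    unfolding set_lebesgue_integral_def integral_bounded_linear[OF bounded_linear_fst int, symmetric]
    by simp
  also have "\<dots> = integral {a..b} (\<lambda>x. x * (L x - g x))"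
  proof (intro region_between_integral continuous_intros contg contL)
    fix x assume "a < x" "x < b"
    then show "((\<lambda>y. fst (x, y)) has_integral x * (L x - g x)) {g x..L x}"
      using has_integral_const_real[of x "g x" "L x"] le[of x] by (simp add: mult.commute)
  qed
  finally have 1: "fst (LINT p:?R|lborel. p) = \<dots>" .
  have "snd (LINT p:?R|lborel. p) = (LINT p:?R|lborel. snd p)"
    unfolding set_lebesgue_integral_def integral_bounded_linear[OF bounded_linear_snd int, symmetric]
    by simp
  also have "\<dots> = integral {a..b} (\<lambda>x. ((L x)\<^sup>2 - (g x)\<^sup>2) / 2)"
  proof (intro region_between_integral continuous_intros contg contL)
    fix x assume "a < x" "x < b"
    then show "((\<lambda>y. snd (x, y)) has_integral ((L x)\<^sup>2 - (g x)\<^sup>2) / 2) {g x..L x}"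
      using ident_has_integral[of "g x" "L x"] le[of x] by (simp add: diff_divide_distrib)
  qed auto
  finally have 2: "snd (LINT p:?R|lborel. p) = \<dots>" .
  show ?thesis
    unfolding centroid_def area by (rule prod_eqI) (simp_all add: 1 2)
qed

end

section \<open>Parabolas with vertical axis as graphs of quadratic functions\<close>

text \<open>The foot of the perpendicular gives the upper bound; the lower bound holds because
  \<open>snd\<close> does not increase distances.\<close>

lemma infdist_horizontal_line:
  assumes "d \<noteq> 0"
  shows "infdist (x, y) (line_through Q (d, 0)) = \<bar>y - snd Q\<bar>"
proof -
  have L: "line_through Q (d, 0) = {p :: plane. snd p = snd Q}" (is "?L = _")
  proof (intro equalityI subsetI)
    fix p :: plane assume "p \<in> {p. snd p = snd Q}"
    then have "p = Q + ((fst p - fst Q) / d) *\<^sub>R (d, 0)"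
      using assms by (intro prod_eqI) auto
    then show "p \<in> ?L"
      unfolding line_through_def by blast
  qed (auto simp: line_through_def)
  show ?thesis
  proof (rule antisym)
    have "infdist (x, y) ?L \<le> dist (x, y) (x, snd Q)"
      by (rule infdist_le) (simp add: L)
    then show "infdist (x, y) ?L \<le> \<bar>y - snd Q\<bar>"
      by (simp add: dist_Pair_Pair dist_real_def)
    have "\<bar>y - snd Q\<bar> \<le> dist (x, y) p" if "p \<in> ?L" for p
      using dist_snd_le[of "(x, y)" p] that by (simp add: L dist_real_def)
    then show "\<bar>y - snd Q\<bar> \<le> infdist (x, y) ?L"
      unfolding infdist_def using L by (auto intro!: cINF_greatest)
  qed
qed

text \<open>After squaring, the terms in \<open>y * y\<close> cancel. What remains is linear in
  \<open>y\<close> with coefficient \<open>2 * (snd F - snd Q)\<close>, nonzero because the focus is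
  off the directrix.\<close>

lemma mem_parabola_horizontal_directrix:
  assumes "d \<noteq> 0" and ne: "snd F \<noteq> snd Q"
  shows "(x, y) \<in> parabola F (line_through Q (d, 0)) \<longleftrightarrow>
    y = 1 / (2 * (snd F - snd Q)) * (x - fst F)\<^sup>2 + (snd F + snd Q) / 2"
proof -
  have "(x, y) \<in> parabola F (line_through Q (d, 0)) \<longleftrightarrow>
      sqrt ((x - fst F)\<^sup>2 + (y - snd F)\<^sup>2) = sqrt ((y - snd Q)\<^sup>2)"
    by (cases F) (simp add: parabola_def infdist_horizontal_line[OF assms(1)] dist_Pair_Pair
      dist_real_def)
  also have "\<dots> \<longleftrightarrow> (x - fst F)\<^sup>2 + (y - snd F)\<^sup>2 = (y - snd Q)\<^sup>2"
    by (simp del: real_sqrt_abs)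
  also have "\<dots> \<longleftrightarrow> y = 1 / (2 * (snd F - snd Q)) * (x - fst F)\<^sup>2 + (snd F + snd Q) / 2"
    using ne by (simp add: field_simps power2_eq_square) argo
  finally show ?thesis .
qed

text \<open>A vertical axis has constant abscissa; comparing its points \<open>F\<close> and
  \<open>F + n\<close> makes \<open>n\<close> vertical, so the directrix is horizontal by
  orthogonality. The sign of \<open>c\<close> is left open here; it comes later from
  convexity.\<close>

lemma parabola_vertical_axis_imp_quadratic:
  assumes "parabola_with_axis C A" "A = line_through R (0, 1)"
  obtains c p q where "C = {(x, y). y = c * (x - p)\<^sup>2 + q}"
proof -
  obtain F Q d n where ne: "d \<noteq> 0" "n \<noteq> 0" "d \<bullet> n = 0" "F \<notin> line_through Q d"
    and C: "C = parabola F (line_through Q d)" and A: "A = line_through F n"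
    using assms(1) by (auto simp: parabola_with_axis_def)
  have "line_through F n = line_through R (0, 1)"
    using A assms(2) by simp
  then have "fst p = fst R" if "p \<in> line_through F n" for p
    using that by (simp only:) (auto simp: line_through_def)
  moreover have "F + 0 *\<^sub>R n \<in> line_through F n" "F + 1 *\<^sub>R n \<in> line_through F n"
    unfolding line_through_def by blast+
  ultimately have "fst (F + 0 *\<^sub>R n) = fst R" "fst (F + 1 *\<^sub>R n) = fst R"
    by blast+
  then have "fst n = 0"
    by simp
  then have "snd d = 0" "fst d \<noteq> 0"
    using ne(1-3) by (auto simp: prod_eq_iff inner_prod_def)
  then have d: "d = (fst d, 0)"
    by (simp add: prod_eq_iff)
  have "snd F \<noteq> snd Q"
  proof
    assume "snd F = snd Q"
    then have "F = Q + ((fst F - fst Q) / fst d) *\<^sub>R d"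
      using \<open>fst d \<noteq> 0\<close> \<open>snd d = 0\<close> by (simp add: prod_eq_iff)
    then show False
      using ne(4) unfolding line_through_def by blast
  qed
  from mem_parabola_horizontal_directrix[OF \<open>fst d \<noteq> 0\<close> this]
  have "C = {(x, y). y = 1 / (2 * (snd F - snd Q)) * (x - fst F)\<^sup>2 + (snd F + snd Q) / 2}"
    unfolding C by (subst d) (auto simp only: set_eq_iff split_paired_All mem_Collect_eq prod.case)
  then show thesis
    by (rule that)
qed

lemma quadratic_graph_is_parabola:
  assumes "c > 0"
  shows "parabola_with_axis {(x, y). y = c * (x - p)\<^sup>2 + q} (line_through (p, q + 1 / (4 * c)) (0, 1))"
proof -
  \<comment> \<open>Focus and directrix lie at the focal distance \<open>1 / (4 * c)\<close> above
    and below the vertex \<open>(p, q)\<close>, so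
    \<open>snd F - snd Q = 1 / (2 * c)\<close>.\<close>
  let ?F = "(p, q + 1 / (4 * c))" and ?Q = "(p, q - 1 / (4 * c))"
  have "parabola ?F (line_through ?Q (1, 0)) = {(x, y). y = c * (x - p)\<^sup>2 + q}"
    using mem_parabola_horizontal_directrix[of 1 ?F ?Q] assms by auto
  moreover have "?F \<notin> line_through ?Q (1, 0)"
    using assms by (auto simp: line_through_def)
  ultimately show ?thesis
    unfolding parabola_with_axis_def
    by - (rule exI[of _ ?F], rule exI[of _ ?Q], rule exI[of _ "(1, 0)"],
        rule exI[of _ "(0, 1)"], simp add: prod_eq_iff)
qed

text \<open>The graph over \<open>I\<close> is the trace on \<open>C\<close> of the open vertical
  strip over \<open>I\<close>, and a continuous image of an interval.\<close>

lemma open_part_of_graph: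
  assumes "open I" "is_interval I" "continuous_on I g"
    and C: "C = {(x, y). y = f x}" and eq: "\<And>x. x \<in> I \<Longrightarrow> g x = f x"
  shows "open_part_of (graph_on g I) C"
  unfolding open_part_of_def
proof
  have "graph_on g I = C \<inter> fst -` I"
    using eq by (auto simp: C mem_graph_on_iff)
  moreover have "open (fst -` I :: plane set)"
    using \<open>open I\<close> by (rule open_vimage_fst)
  ultimately show "openin (top_of_set C) (graph_on g I)"
    by (simp add: openin_open_Int)
  show "connected (graph_on g I)"
    unfolding graph_on_def graph_point_def
    using assms(2,3) is_interval_connected
    by (intro connected_continuous_image continuous_intros) auto
qed

section \<open>Cutting lines and sections in coordinates\<close>

text \<open>Moving the tangent by \<open>h\<close> along the normal raises it vertically by
  \<open>h * s\<close>, where \<open>s = sqrt (1 + m * m)\<close> for the slope \<open>m\<close>: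
  the shifted base point contributes \<open>h / s + m * (h * m / s)\<close>, which is
  \<open>h * s\<close> by \<open>s * s = 1 + m * m\<close>.\<close>

lemma mem_cutting_line_iff:
  "(x, y) \<in> cutting_line g u h \<longleftrightarrow>
     y = g u + deriv g u * (x - u) + h * sqrt (1 + (deriv g u)\<^sup>2)"
proof -
  define m s where "m = deriv g u" and "s = sqrt (1 + m\<^sup>2)"
  have "s > 0" and s2: "s * s = 1 + m * m"
    by (auto simp: s_def add_pos_nonneg power2_eq_square[symmetric])
  have s: "h / s + m * (h * m / s) = h * s"
    using \<open>s > 0\<close> s2 by (simp add: field_simps)
  have "(x, y) \<in> cutting_line g u h \<longleftrightarrow>
      (\<exists>t. x = u - h * m / s + t \<and> y = g u + h / s + t * m)"
    by (auto simp: cutting_line_def line_through_def graph_point_def upward_normal_def m_def s_def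
      algebra_simps)
  also have "\<dots> \<longleftrightarrow> y = g u + h / s + (x - u + h * m / s) * m"
    by (auto intro!: exI[of _ "x - u + h * m / s"])
  also have "\<dots> \<longleftrightarrow> y = g u + m * (x - u) + h * s"
    using s by (auto simp: algebra_simps)
  finally show ?thesis
    by (simp add: m_def s_def)
qed

lemma mem_vertical_line_iff: "(x, y) \<in> line_through (graph_point g u) (0, 1) \<longleftrightarrow> x = u"
  by (auto simp: line_through_def graph_point_def intro!: exI[of _ "y - g u"])

lemma cut_section_eq_region_between:
  assumes "a < b" "continuous_on {a..b} g" and "g a = p + k * a" "g b = p + k * b"
    and "\<And>x. a < x \<Longrightarrow> x < b \<Longrightarrow> g x < p + k * x"
  shows "cut_section g a b = region_between g (\<lambda>x. p + k * x) a b"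
proof -
  have "closed_segment (graph_point g a) (graph_point g b) = graph_on (\<lambda>x. p + k * x) {a..b}"
    using graph_on_affine_eq_closed_segment[of a b p k] assms by (simp add: graph_point_def)
  then show ?thesis
    unfolding cut_section_def using assms
    by (simp only:) (intro inside_two_graphs continuous_intros; simp)
qed

text \<open>The function \<open>f\<close> of the opening explanation. Subtracting the tangent at
  \<open>u\<close> turns the cutting lines at \<open>u\<close> into horizontal lines.\<close>

definition tangent_gap :: "(real \<Rightarrow> real) \<Rightarrow> real \<Rightarrow> real \<Rightarrow> real" where
  "tangent_gap g u x = g x - g u - deriv g u * (x - u)"

section \<open>Monotonicity of the tangent gap and centroids of sections\<close>

locale strictly_convex_graph =
  fixes g :: "real \<Rightarrow> real" and I :: "real set"
  assumes open_I: "open I" and interval_I: "is_interval I"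
    and convex_g: "strictly_convex_C3 g I"
begin

lemma iterated_deriv:
  assumes "x \<in> I" "k < 3"
  shows "((deriv ^^ k) g has_real_derivative (deriv ^^ Suc k) g x) (at x)"
proof -
  have "(deriv ^^ k) g differentiable (at x within I)"
    using convex_g assms unfolding strictly_convex_C3_def differentiable_on_def by blast
  then have "(deriv ^^ k) g differentiable (at x)"
    by (simp only: at_within_open[OF assms(1) open_I])
  then show ?thesis
    by (simp only: DERIV_deriv_iff_real_differentiable funpow.simps o_apply)
qed

lemma g_deriv: "x \<in> I \<Longrightarrow> (g has_real_derivative deriv g x) (at x)"
  using iterated_deriv[of x 0] by simp

lemma g_deriv2: "x \<in> I \<Longrightarrow> (deriv g has_real_derivative (deriv ^^ 2) g x) (at x)"
  using iterated_deriv[of x 1] unfolding Suc_1 by simp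

lemma g_deriv3: "x \<in> I \<Longrightarrow> ((deriv ^^ 2) g has_real_derivative (deriv ^^ 3) g x) (at x)"
  using iterated_deriv[of x 2] by simp

lemma deriv2_pos: "x \<in> I \<Longrightarrow> (deriv ^^ 2) g x > 0"
  using convex_g by (simp add: strictly_convex_C3_def)

lemma continuous_g: "S \<subseteq> I \<Longrightarrow> continuous_on S g"
  by (intro continuous_at_imp_continuous_on ballI DERIV_isCont[OF g_deriv]) (rule subsetD)

lemma Icc_subset_I: "a \<in> I \<Longrightarrow> b \<in> I \<Longrightarrow> {a..b} \<subseteq> I"
  using interval_I unfolding is_interval_1 by (meson atLeastAtMost_iff subsetI)

lemma deriv_strict_mono:
  assumes "x \<in> I" "y \<in> I" "x < y"
  shows "deriv g x < deriv g y"
  using assms(3)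
proof (rule DERIV_pos_imp_increasing)
  fix z assume "x \<le> z" "z \<le> y"
  then have "z \<in> I"
    using Icc_subset_I[OF assms(1,2)] by auto
  then show "\<exists>d. (deriv g has_real_derivative d) (at z) \<and> 0 < d"
    by (intro exI[of _ "(deriv ^^ 2) g z"] conjI g_deriv2 deriv2_pos)
qed

lemma tangent_gap_deriv:
  "x \<in> I \<Longrightarrow> (tangent_gap g u has_real_derivative deriv g x - deriv g u) (at x)"
  unfolding tangent_gap_def[abs_def] by (auto intro!: derivative_eq_intros g_deriv)

lemma continuous_tangent_gap: "S \<subseteq> I \<Longrightarrow> continuous_on S (tangent_gap g u)"
  by (intro continuous_at_imp_continuous_on ballI DERIV_isCont[OF tangent_gap_deriv]) (rule subsetD)

lemma tangent_gap_strict_mono: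
  assumes "u \<in> I" "y \<in> I" "u \<le> x" "x < y"
  shows "tangent_gap g u x < tangent_gap g u y"
  using assms(4)
\<comment> \<open>Only interior points are tested, because for \<open>x = u\<close> the derivative
  \<open>deriv g z - deriv g u\<close> vanishes at the left end.\<close>
proof (rule DERIV_pos_imp_increasing_open)
  have sub: "{x..y} \<subseteq> I"
    using assms(3) by (intro order_trans[OF _ Icc_subset_I[OF assms(1,2)]]) simp
  then show "continuous_on {x..y} (tangent_gap g u)"
    by (rule continuous_tangent_gap)
  fix z assume "x < z" "z < y"
  then show "\<exists>d. (tangent_gap g u has_real_derivative d) (at z) \<and> 0 < d"
    using deriv_strict_mono[of u z] tangent_gap_deriv[of z u] subsetD[OF sub, of z] assms(1,3)
    by (intro exI[of _ "deriv g z - deriv g u"]) auto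
qed

lemma tangent_gap_strict_antimono:
  assumes "u \<in> I" "y \<in> I" "y < x" "x \<le> u"
  shows "tangent_gap g u x < tangent_gap g u y"
  using assms(3)
proof (rule DERIV_neg_imp_decreasing_open)
  have sub: "{y..x} \<subseteq> I"
    using assms(4) by (intro order_trans[OF _ Icc_subset_I[OF assms(2,1)]]) simp
  then show "continuous_on {y..x} (tangent_gap g u)"
    by (rule continuous_tangent_gap)
  fix z assume "y < z" "z < x"
  then show "\<exists>d. (tangent_gap g u has_real_derivative d) (at z) \<and> d < 0"
    using deriv_strict_mono[of z u] tangent_gap_deriv[of z u] subsetD[OF sub, of z] assms(1,4)
    by (intro exI[of _ "deriv g z - deriv g u"]) auto
qed

lemma cut_abscissae_iff:
  "cut_abscissae g I u h a b \<longleftrightarrow> a \<in> I \<and> b \<in> I \<and> a < u \<and> u < b \<and>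
     tangent_gap g u a = h * sqrt (1 + (deriv g u)\<^sup>2) \<and>
     tangent_gap g u b = h * sqrt (1 + (deriv g u)\<^sup>2)"
  by (auto simp: cut_abscissae_def graph_point_def mem_cutting_line_iff tangent_gap_def)

text \<open>Away from \<open>u\<close> the gap increases strictly up to its value \<open>H\<close>
  at both ends, so the arc lies strictly below the chord and the section is a
  \<open>region_between\<close>. Positivity of \<open>A\<close> allows the denominators to be
  cleared later.\<close>

lemma centroid_cut_section:
  assumes "u \<in> I" and cut: "cut_abscissae g I u h a b"
  defines "H \<equiv> h * sqrt (1 + (deriv g u)\<^sup>2)"
  defines "L \<equiv> \<lambda>x. g u + deriv g u * (x - u) + H"
  defines "A \<equiv> integral {a..b} (\<lambda>x. L x - g x)"
  shows "centroid (cut_section g a b) =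
      (integral {a..b} (\<lambda>x. x * (L x - g x)) / A,
       integral {a..b} (\<lambda>x. ((L x)\<^sup>2 - (g x)\<^sup>2) / 2) / A)"
    and "A > 0"
    and "\<And>x. x \<in> {a..b} \<Longrightarrow> tangent_gap g u x \<le> H"
proof -
  have ab: "a \<in> I" "b \<in> I" "a < u" "u < b" "tangent_gap g u a = H" "tangent_gap g u b = H"
    using cut by (auto simp: cut_abscissae_iff H_def)
  note sub = Icc_subset_I[OF ab(1,2)]
  have less: "tangent_gap g u x < H" if "a < x" "x < b" for x
    using tangent_gap_strict_mono[of u b x] tangent_gap_strict_antimono[of u a x] that ab \<open>u \<in> I\<close>
    by (cases "u \<le> x") auto
  then show "tangent_gap g u x \<le> H" if "x \<in> {a..b}" for x
    using that ab by (cases "x = a \<or> x = b") (auto intro: less_imp_le)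
  define q where "q = g u - deriv g u * u + H"
  have L: "L = (\<lambda>x. q + deriv g u * x)"
    by (auto simp: L_def q_def algebra_simps)
  have gap: "tangent_gap g u x = H + g x - L x" for x
    by (simp add: tangent_gap_def L_def)
  have cont: "continuous_on {a..b} g" "continuous_on {a..b} L"
    using continuous_g[OF sub] by (auto simp: L intro!: continuous_intros)
  have below: "g x < L x" if "a < x" "x < b" for x
    using less[OF that] by (simp add: gap)
  have "g a = L a" "g b = L b"
    using gap[of a] gap[of b] ab(5,6) by simp_all
  then have "cut_section g a b = region_between g L a b"
    unfolding L using ab(3,4) below[unfolded L] cont(1)
    by (intro cut_section_eq_region_between) auto
  moreover have "centroid (region_between g L a b) =
      (integral {a..b} (\<lambda>x. x * (L x - g x)) / A,
       integral {a..b} (\<lambda>x. ((L x)\<^sup>2 - (g x)\<^sup>2) / 2) / A)"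
    unfolding A_def using below cont
    by (intro centroid_region_between) (auto intro: less_imp_le)
  ultimately show "centroid (cut_section g a b) =
      (integral {a..b} (\<lambda>x. x * (L x - g x)) / A,
       integral {a..b} (\<lambda>x. ((L x)\<^sup>2 - (g x)\<^sup>2) / 2) / A)"
    by simp
  have "integral {a..b} (\<lambda>x. 0) < A"
    unfolding A_def using below ab(3,4) cont
    by (intro integral_less_real continuous_intros) auto
  then show "A > 0"
    by simp
qed

text \<open>The asymmetry of the gap is known only within some \<open>\<delta>\<close> of
  \<open>u\<close>, so the section has to fit there. Once the level \<open>h * s\<close> is below
  the gap at both \<open>u - d\<close> and \<open>u + d\<close>, monotonicity on each side confines
  \<open>a\<close> and \<open>b\<close>.\<close>

lemma cut_abscissae_eventually_close:
  assumes "u \<in> I" "\<delta> > 0"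
  shows "\<forall>\<^sub>F h in at_right 0. \<forall>a b. cut_abscissae g I u h a b \<longrightarrow> u - \<delta> < a \<and> b < u + \<delta>"
proof -
  obtain e where e: "e > 0" "cball u e \<subseteq> I"
    using open_I assms(1) open_contains_cball by blast
  define d where "d = min \<delta> e"
  have d: "d > 0" "d \<le> \<delta>" "u - d \<in> I" "u + d \<in> I"
    using e assms(2) by (auto simp: d_def dist_real_def subset_iff)
  define s where "s = sqrt (1 + (deriv g u)\<^sup>2)"
  have "s > 0"
    by (auto simp: s_def add_pos_nonneg)
  define M where "M = min (tangent_gap g u (u - d)) (tangent_gap g u (u + d))"
  have "M > 0"
    using tangent_gap_strict_mono[of u "u + d" u] tangent_gap_strict_antimono[of u "u - d" u] d assms(1)
    by (simp add: M_def tangent_gap_def)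
  then have "M / s > 0"
    using \<open>s > 0\<close> by simp
  then have "\<forall>\<^sub>F h in at_right 0. h < M / s"
    using eventually_at_right_real[of 0 "M / s"] by (auto elim: eventually_mono)
  then show ?thesis
  proof eventually_elim
    case (elim h)
    then have h: "h * s < M"
      using \<open>s > 0\<close> by (simp add: pos_less_divide_eq)
    show ?case
    proof (intro allI impI)
      fix a b assume "cut_abscissae g I u h a b"
      then have ab: "a \<in> I" "b \<in> I" "a < u" "u < b" "tangent_gap g u a < M" "tangent_gap g u b < M"
        using h by (auto simp: cut_abscissae_iff s_def)
      have "u - d < a"
        using tangent_gap_strict_antimono[of u a "u - d"] ab assms(1) d
        by (cases "a = u - d") (fastforce simp: M_def)+
      moreover have "b < u + d"
        using tangent_gap_strict_mono[of u b "u + d"] ab assms(1) d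
        by (cases "b = u + d") (fastforce simp: M_def)+
      ultimately show "u - \<delta> < a \<and> b < u + \<delta>"
        using d by simp
    qed
  qed
qed

section \<open>From centroids with abscissa \<open>u\<close> to a quadratic function\<close>

lemma third_deriv_eq_0:
  assumes "u \<in> I"
    and ev: "\<forall>\<^sub>F h in at_right 0. \<exists>a b. cut_abscissae g I u h a b \<and>
      fst (centroid (cut_section g a b)) = u"
  shows "(deriv ^^ 3) g u = 0"
proof (rule ccontr)
  assume "(deriv ^^ 3) g u \<noteq> 0"
  have odd: "tangent_gap g u (u + t) - tangent_gap g u (u - t)
      = g (u + t) - g (u - t) - 2 * deriv g u * t" for t
    by (simp add: tangent_gap_def)
  from \<open>(deriv ^^ 3) g u \<noteq> 0\<close> consider "(deriv ^^ 3) g u > 0" | "(deriv ^^ 3) g u < 0"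
    by linarith
  then obtain \<delta> where "\<delta> > 0" and
    asym: "(\<forall>t. 0 < t \<longrightarrow> t < \<delta> \<longrightarrow> tangent_gap g u (u - t) < tangent_gap g u (u + t)) \<or>
           (\<forall>t. 0 < t \<longrightarrow> t < \<delta> \<longrightarrow> tangent_gap g u (u + t) < tangent_gap g u (u - t))"
  proof cases
    case 1
    have "\<exists>\<delta>>0. \<forall>t. 0 < t \<longrightarrow> t < \<delta> \<longrightarrow> 2 * deriv g u * t < g (u + t) - g (u - t)"
      by (rule odd_part_gt_tangent[OF open_I assms(1) g_deriv g_deriv2 g_deriv3[OF assms(1)] 1])
    then obtain d where "d > 0" and
      "\<And>t. 0 < t \<Longrightarrow> t < d \<Longrightarrow> 2 * deriv g u * t < g (u + t) - g (u - t)"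
      by blast
    then have "\<forall>t. 0 < t \<longrightarrow> t < d \<longrightarrow> tangent_gap g u (u - t) < tangent_gap g u (u + t)"
      using odd by (smt (verit))
    then show thesis
      using that \<open>d > 0\<close> by blast
  next
    case 2
    \<comment> \<open>The same estimate applied to \<open>- g\<close>, whose third derivative at
      \<open>u\<close> is positive.\<close>
    have "\<exists>\<delta>>0. \<forall>t. 0 < t \<longrightarrow> t < \<delta> \<longrightarrow> 2 * (- deriv g u) * t < - g (u + t) - - g (u - t)"
      by (rule odd_part_gt_tangent[OF open_I assms(1),
          where ?F2.0 = "\<lambda>x. - (deriv ^^ 2) g x" and D = "- (deriv ^^ 3) g u"])
        (use 2 assms(1) in \<open>auto intro!: derivative_intros g_deriv g_deriv2 g_deriv3\<close>)
    then obtain d where "d > 0" and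
      "\<And>t. 0 < t \<Longrightarrow> t < d \<Longrightarrow> 2 * (- deriv g u) * t < - g (u + t) - - g (u - t)"
      by blast
    then have "\<forall>t. 0 < t \<longrightarrow> t < d \<longrightarrow> tangent_gap g u (u + t) < tangent_gap g u (u - t)"
      using odd by (smt (verit) mult_minus_left mult_minus_right)
    then show thesis
      using that \<open>d > 0\<close> by blast
  qed
  \<comment> \<open>One small \<open>h\<close> with both properties is enough for the
    contradiction.\<close>
  have "\<exists>h. (\<exists>a b. cut_abscissae g I u h a b \<and> fst (centroid (cut_section g a b)) = u) \<and>
      (\<forall>a b. cut_abscissae g I u h a b \<longrightarrow> u - \<delta> < a \<and> b < u + \<delta>)"
    using eventually_happens[OF eventually_conj[OF ev
      cut_abscissae_eventually_close[OF assms(1) \<open>\<delta> > 0\<close>]]] by simp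
  then obtain h a b where cut: "cut_abscissae g I u h a b"
    and G: "fst (centroid (cut_section g a b)) = u" and close: "u - \<delta> < a" "b < u + \<delta>"
    by blast
  define H where "H = h * sqrt (1 + (deriv g u)\<^sup>2)"
  define k where "k t = H - tangent_gap g u (u + t)" for t
  define A where "A = integral {a..b} (\<lambda>x. H - tangent_gap g u x)"
  have gap: "g u + deriv g u * (x - u) + H - g x = H - tangent_gap g u x" for x
    by (simp add: tangent_gap_def)
  note C = centroid_cut_section[OF assms(1) cut, folded H_def, unfolded gap, folded A_def]
  have ab: "a \<in> I" "b \<in> I" "a < u" "u < b" "tangent_gap g u a = H" "tangent_gap g u b = H"
    using cut by (auto simp: cut_abscissae_iff H_def)
  have cont: "continuous_on {a..b} (tangent_gap g u)"
    using Icc_subset_I[OF ab(1,2)] by (rule continuous_tangent_gap)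
  have contk: "continuous_on {-(u - a)..b - u} k"
    unfolding k_def by (intro continuous_intros continuous_on_compose2[OF cont]) auto
  \<comment> \<open>The centroid condition with the denominator \<open>A\<close> cleared.
    Subtracting \<open>u * A\<close> from both sides gives a vanishing moment about
    \<open>u\<close>, which the substitution \<open>x = u + t\<close> moves to 0.\<close>
  have "integral {a..b} (\<lambda>x. x * (H - tangent_gap g u x)) = u * A"
    using G C(1,2) by (simp add: field_simps)
  moreover have "integral {a..b} (\<lambda>x. (x - u) * (H - tangent_gap g u x)) =
      integral {a..b} (\<lambda>x. x * (H - tangent_gap g u x))
      - integral {a..b} (\<lambda>x. u * (H - tangent_gap g u x))"
    unfolding left_diff_distrib
    by (intro Henstock_Kurzweil_Integration.integral_diff integrable_continuous_real continuous_intros cont)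
  ultimately have "integral {a..b} (\<lambda>x. (x - u) * (H - tangent_gap g u x)) = 0"
    by (simp add: A_def)
  then have moment: "integral {-(u - a)..b - u} (\<lambda>t. t * k t) = 0"
    using integral_shift_Icc_real[of "a - u" "b - u" "\<lambda>x. (x - u) * (H - tangent_gap g u x)" u]
    by (simp add: k_def o_def)
  have k: "0 \<le> k t" if "t \<in> {-(u - a)..b - u}" for t
    using C(3)[of "u + t"] that by (simp add: k_def)
  have kab: "k (-(u - a)) = 0" "k (b - u) = 0"
    using ab by (auto simp: k_def)
  \<comment> \<open>Since \<open>k\<close> is \<open>H\<close> minus the gap, its asymmetry is
    opposite to that of the gap. The bounds \<open>u - a < \<delta>\<close> and
    \<open>b - u < \<delta>\<close> keep every relevant \<open>t\<close> in range.\<close>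
  from asym show False
  proof
    assume "\<forall>t. 0 < t \<longrightarrow> t < \<delta> \<longrightarrow> tangent_gap g u (u - t) < tangent_gap g u (u + t)"
    then have "integral {-(u - a)..b - u} (\<lambda>t. t * k t) < 0"
      using ab close by (intro first_moment_neg contk k kab) (auto simp: k_def)
    then show False
      using moment by simp
  next
    assume "\<forall>t. 0 < t \<longrightarrow> t < \<delta> \<longrightarrow> tangent_gap g u (u + t) < tangent_gap g u (u - t)"
    then have "0 < integral {-(u - a)..b - u} (\<lambda>t. t * k t)"
      using ab close by (intro first_moment_pos contk k kab) (auto simp: k_def)
    then show False
      using moment by simp
  qed
qed

text \<open>Three integrations over the interval, each producing one constant (\<open>2 * c\<close>,
  then \<open>b\<close>, then \<open>d\<close>), followed by completing the square. Positivity of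
  \<open>c\<close> is that of the second derivative.\<close>

lemma quadratic_if_third_deriv_0:
  assumes "\<And>x. x \<in> I \<Longrightarrow> (deriv ^^ 3) g x = 0" "I \<noteq> {}"
  obtains c p q where "c > 0" "\<And>x. x \<in> I \<Longrightarrow> g x = c * (x - p)\<^sup>2 + q"
proof -
  have const: "\<exists>k. \<forall>x\<in>I. f x = k" if "\<And>x. x \<in> I \<Longrightarrow> (f has_real_derivative 0) (at x)"
    for f :: "real \<Rightarrow> real"
    using interval_I that
    by (intro has_field_derivative_zero_constant is_interval_convex) (auto intro: has_field_derivative_at_within)
  obtain c where c: "\<And>x. x \<in> I \<Longrightarrow> (deriv ^^ 2) g x = 2 * c"
    using const[of "\<lambda>x. (deriv ^^ 2) g x / 2"] g_deriv3 assms(1)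
    by (fastforce intro!: derivative_eq_intros)
  have "c > 0"
    using c deriv2_pos assms(2) by fastforce
  obtain b where b: "\<And>x. x \<in> I \<Longrightarrow> deriv g x - 2 * c * x = b"
    using const[of "\<lambda>x. deriv g x - 2 * c * x"] g_deriv2 c
    by (fastforce intro!: derivative_eq_intros)
  obtain d where d: "\<And>x. x \<in> I \<Longrightarrow> g x - c * x\<^sup>2 - b * x = d"
    using const[of "\<lambda>x. g x - c * x\<^sup>2 - b * x"] g_deriv b
    by (fastforce intro!: derivative_eq_intros)
  show thesis
  proof (rule that[OF \<open>c > 0\<close>])
    fix x assume "x \<in> I"
    from d[OF this] show "g x = c * (x - (- b / (2 * c)))\<^sup>2 + (d - b\<^sup>2 / (4 * c))"
      using \<open>c > 0\<close> by (simp add: field_simps power2_eq_square)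
  qed
qed

end

section \<open>Centroids of parabolic segments\<close>

text \<open>The factor \<open>c * (r\<^sup>2 - (x - u)\<^sup>2)\<close> is the height of a parabolic
  segment of half-width \<open>r\<close>, with area \<open>4 / 3 * c * r ^ 3\<close>. A general
  quadratic weight covers area and both moments at once; the \<open>\<beta>\<close> term cancels by
  symmetry about \<open>u\<close>.\<close>

lemma parabolic_segment_integral:
  fixes c r u :: real
  assumes "0 \<le> r"
  shows "integral {u - r..u + r}
      (\<lambda>x. c * (r\<^sup>2 - (x - u)\<^sup>2) * (\<alpha> + \<beta> * (x - u) + \<gamma> * (x - u)\<^sup>2))
    = (\<alpha> + \<gamma> * r\<^sup>2 / 5) * (4 / 3 * c * r ^ 3)"
proof -
  \<comment> \<open>An antiderivative in the centered variable \<open>t = x - u\<close>.\<close>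
  define W where "W t = c * (\<alpha> * (r\<^sup>2 * t - t ^ 3 / 3) + \<beta> * (r\<^sup>2 * t\<^sup>2 / 2 - t ^ 4 / 4)
      + \<gamma> * (r\<^sup>2 * t ^ 3 / 3 - t ^ 5 / 5))" for t
  have "(W has_real_derivative c * (\<alpha> * (r\<^sup>2 - t\<^sup>2) + \<beta> * (r\<^sup>2 * t - t ^ 3)
      + \<gamma> * (r\<^sup>2 * t\<^sup>2 - t ^ 4))) (at t)" for t
    unfolding W_def[abs_def] by (auto intro!: derivative_eq_intros simp: algebra_simps)
  moreover have "c * (\<alpha> * (r\<^sup>2 - t\<^sup>2) + \<beta> * (r\<^sup>2 * t - t ^ 3) + \<gamma> * (r\<^sup>2 * t\<^sup>2 - t ^ 4))
      = c * (r\<^sup>2 - t\<^sup>2) * (\<alpha> + \<beta> * t + \<gamma> * t\<^sup>2)" for t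
    by algebra
  ultimately have W: "(W has_real_derivative c * (r\<^sup>2 - t\<^sup>2) * (\<alpha> + \<beta> * t + \<gamma> * t\<^sup>2)) (at t)" for t
    by simp
  have shift: "((\<lambda>x. x - u) has_real_derivative 1) (at x)" for x
    by (auto intro!: derivative_eq_intros)
  have "((\<lambda>x. W (x - u)) has_real_derivative
      c * (r\<^sup>2 - (x - u)\<^sup>2) * (\<alpha> + \<beta> * (x - u) + \<gamma> * (x - u)\<^sup>2)) (at x)" for x
    using DERIV_chain2[OF W shift] by simp
  then have "integral {u - r..u + r}
      (\<lambda>x. c * (r\<^sup>2 - (x - u)\<^sup>2) * (\<alpha> + \<beta> * (x - u) + \<gamma> * (x - u)\<^sup>2))
    = W (u + r - u) - W (u - r - u)"
    using assms by (intro integral_unique fundamental_theorem_of_calculus)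
      (auto simp: has_real_derivative_iff_has_vector_derivative[symmetric]
        intro: has_field_derivative_at_within)
  also have "\<dots> = (\<alpha> + \<gamma> * r\<^sup>2 / 5) * (4 / 3 * c * r ^ 3)"
    unfolding W_def by (simp add: field_simps eval_nat_numeral)
  finally show ?thesis .
qed

context strictly_convex_graph
begin

lemma centroid_cut_section_quadratic:
  assumes quad: "\<And>x. x \<in> I \<Longrightarrow> g x = c * (x - p)\<^sup>2 + q" and "u \<in> I"
  shows "c > 0"
    and "\<forall>\<^sub>F h in at_right 0. \<exists>a b. cut_abscissae g I u h a b \<and>
      centroid (cut_section g a b) = (u, g u + 3 / 5 * (h * sqrt (1 + (deriv g u)\<^sup>2)))"
proof -
  have dg: "deriv g x = 2 * c * (x - p)" if "x \<in> I" for x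
  proof (rule DERIV_imp_deriv)
    have "((\<lambda>x. c * (x - p)\<^sup>2 + q) has_real_derivative 2 * c * (x - p)) (at x)"
      by (auto intro!: derivative_eq_intros)
    then show "(g has_real_derivative 2 * c * (x - p)) (at x)"
      by (rule has_field_derivative_transform_within_open[OF _ open_I that]) (simp add: quad)
  qed
  have "((\<lambda>x. 2 * c * (x - p)) has_real_derivative 2 * c) (at u)"
    by (auto intro!: derivative_eq_intros)
  then have "(deriv g has_real_derivative 2 * c) (at u)"
    by (rule has_field_derivative_transform_within_open[OF _ open_I \<open>u \<in> I\<close>]) (simp add: dg)
  then have "2 * c = (deriv ^^ 2) g u"
    using g_deriv2[OF \<open>u \<in> I\<close>] DERIV_unique by blast
  then show "c > 0"
    using deriv2_pos[OF \<open>u \<in> I\<close>] by simp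
  define s where "s = sqrt (1 + (deriv g u)\<^sup>2)"
  have "s > 0"
    by (auto simp: s_def add_pos_nonneg)
  have gap: "tangent_gap g u x = c * (x - u)\<^sup>2" if "x \<in> I" for x
    unfolding tangent_gap_def quad[OF that] quad[OF \<open>u \<in> I\<close>] dg[OF \<open>u \<in> I\<close>] by algebra
  obtain e where e: "e > 0" "cball u e \<subseteq> I"
    using open_I \<open>u \<in> I\<close> open_contains_cball by blast
  \<comment> \<open>For \<open>h\<close> below this threshold the half-width \<open>r\<close>,
    determined by \<open>c * r\<^sup>2 = h * s\<close>, is less than \<open>e\<close>, so the whole
    section lies over \<open>I\<close>.\<close>
  have "c * e\<^sup>2 / s > 0"
    using e \<open>s > 0\<close> \<open>c > 0\<close> by simp
  from eventually_at_right_real[OF this]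
  show "\<forall>\<^sub>F h in at_right 0. \<exists>a b. cut_abscissae g I u h a b \<and>
      centroid (cut_section g a b) = (u, g u + 3 / 5 * (h * sqrt (1 + (deriv g u)\<^sup>2)))"
  proof eventually_elim
    case (elim h)
    define r where "r = sqrt (h * s / c)"
    have "h * s / c > 0"
      using elim \<open>s > 0\<close> \<open>c > 0\<close> by simp
    then have "r > 0" and H: "h * s = c * r\<^sup>2"
      using \<open>c > 0\<close> by (auto simp: r_def)
    have "h * s / c < e\<^sup>2"
      using elim \<open>s > 0\<close> \<open>c > 0\<close> by (simp add: field_simps)
    then have "r < e"
      using e unfolding r_def by (simp add: real_less_lsqrt)
    then have in_I: "{u - r..u + r} \<subseteq> I"
      using e(2) by (auto simp: subset_iff dist_real_def)
    then have ends: "u - r \<in> I" "u + r \<in> I"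
      using \<open>r > 0\<close> by auto
    have cut: "cut_abscissae g I u h (u - r) (u + r)"
      using ends \<open>r > 0\<close> H by (simp add: cut_abscissae_iff gap s_def)
    define L where "L x = g u + deriv g u * (x - u) + c * r\<^sup>2" for x
    define w where "w x = c * (r\<^sup>2 - (x - u)\<^sup>2)" for x
    have g: "g x = L x - w x" if "x \<in> {u - r..u + r}" for x
      using gap[of x] in_I that by (auto simp: L_def w_def tangent_gap_def algebra_simps)
    note segment_integral = parabolic_segment_integral[OF less_imp_le[OF \<open>r > 0\<close>], of u c]
    \<comment> \<open>Each integrand is written as the height \<open>w\<close> times a quadratic in
      \<open>x - u\<close>: 1 for the area, \<open>u + (x - u)\<close> for the abscissa, and
      \<open>L x - w x / 2\<close>, the midpoint of the vertical section, for the ordinate.\<close>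
    have "integral {u - r..u + r} (\<lambda>x. L x - g x)
        = integral {u - r..u + r} (\<lambda>x. w x * (1 + 0 * (x - u) + 0 * (x - u)\<^sup>2))"
      by (rule Henstock_Kurzweil_Integration.integral_cong) (simp add: g)
    moreover have "integral {u - r..u + r} (\<lambda>x. x * (L x - g x))
        = integral {u - r..u + r} (\<lambda>x. w x * (u + 1 * (x - u) + 0 * (x - u)\<^sup>2))"
      by (rule Henstock_Kurzweil_Integration.integral_cong) (simp add: g)
    moreover have "integral {u - r..u + r} (\<lambda>x. ((L x)\<^sup>2 - (g x)\<^sup>2) / 2) = integral {u - r..u + r}
        (\<lambda>x. w x * ((g u + c * r\<^sup>2 / 2) + deriv g u * (x - u) + c / 2 * (x - u)\<^sup>2))"
    proof (rule Henstock_Kurzweil_Integration.integral_cong)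
      fix x assume "x \<in> {u - r..u + r}"
      then have "((L x)\<^sup>2 - (g x)\<^sup>2) / 2 = w x * (L x - w x / 2)"
        by (simp only: g) (simp add: power2_eq_square field_simps)
      also have "L x - w x / 2 = (g u + c * r\<^sup>2 / 2) + deriv g u * (x - u) + c / 2 * (x - u)\<^sup>2"
        by (simp add: L_def w_def field_simps)
      finally show "((L x)\<^sup>2 - (g x)\<^sup>2) / 2
          = w x * ((g u + c * r\<^sup>2 / 2) + deriv g u * (x - u) + c / 2 * (x - u)\<^sup>2)" .
    qed
    \<comment> \<open>The ratio arises here: with \<open>\<alpha> = g u + c * r\<^sup>2 / 2\<close>
      and \<open>\<gamma> = c / 2\<close>, the multiples of \<open>c * r\<^sup>2\<close> in
      \<open>\<alpha> + \<gamma> * r\<^sup>2 / 5\<close> are 1/2 and 1/10, which add up to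
      3/5.\<close>
    ultimately have "integral {u - r..u + r} (\<lambda>x. L x - g x) = 4 / 3 * c * r ^ 3"
      "integral {u - r..u + r} (\<lambda>x. x * (L x - g x)) = u * (4 / 3 * c * r ^ 3)"
      "integral {u - r..u + r} (\<lambda>x. ((L x)\<^sup>2 - (g x)\<^sup>2) / 2)
        = (g u + 3 / 5 * (c * r\<^sup>2)) * (4 / 3 * c * r ^ 3)"
      unfolding w_def segment_integral by simp_all
    then have "centroid (cut_section g (u - r) (u + r)) = (u, g u + 3 / 5 * (h * s))"
      using centroid_cut_section(1)[OF \<open>u \<in> I\<close> cut] \<open>r > 0\<close> \<open>c > 0\<close>
      unfolding s_def[symmetric] H L_def[symmetric] by (simp only:) simp
    then show ?case
      using cut unfolding s_def by blast
  qed
qed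

end

section \<open>The two implications between parabolas and centroids\<close>

lemma fst_eq_if_mem_vertical_segment:
  assumes "G \<in> closed_segment (u, y) (u, z)"
  shows "fst G = (u :: real)"
  using assms by (auto simp: closed_segment_def algebra_simps)

theorem theorem3:
  fixes g :: "real \<Rightarrow> real" and I :: "real set"
  assumes "open I" and "is_interval I" and "I \<noteq> {}"
    and "strictly_convex_C3 g I"
  shows "(\<exists>C A. parabola_with_axis C A \<and> (\<exists>R. A = line_through R (0, 1)) \<and>
            open_part_of (graph_on g I) C)
    \<longleftrightarrow>
    (\<forall>u\<in>I. \<forall>\<^sub>F h in at_right 0. \<exists>a b V.
        cut_abscissae g I u h a b \<and>
        V \<in> line_through (graph_point g u) (0, 1) \<inter> cutting_line g u h \<and>
        (let P = graph_point g u; G = centroid (cut_section g a b)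
         in G \<in> closed_segment P V \<and> dist P G = 3 / 5 * dist P V))"
    (is "?parabola \<longleftrightarrow> ?centroids")
proof
  interpret strictly_convex_graph g I
    using assms by unfold_locales
  show ?centroids if par: ?parabola
  proof
    fix u assume "u \<in> I"
    obtain C A R where "parabola_with_axis C A" "A = line_through R (0, 1)"
      and part: "open_part_of (graph_on g I) C"
      using par by blast
    then obtain c p q where C: "C = {(x, y). y = c * (x - p)\<^sup>2 + q}"
      using parabola_vertical_axis_imp_quadratic by blast
    have "graph_on g I \<subseteq> C"
      using part unfolding open_part_of_def by (blast dest: openin_imp_subset)
    then have quad: "g x = c * (x - p)\<^sup>2 + q" if "x \<in> I" for x
      using that by (auto simp: C graph_on_def graph_point_def)
    have "\<forall>\<^sub>F h in at_right 0. \<exists>a b. cut_abscissae g I u h a b \<and>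
        centroid (cut_section g a b) = (u, g u + 3 / 5 * (h * sqrt (1 + (deriv g u)\<^sup>2)))"
      by (rule centroid_cut_section_quadratic(2)[OF quad \<open>u \<in> I\<close>])
    then show "\<forall>\<^sub>F h in at_right 0. \<exists>a b V. cut_abscissae g I u h a b \<and>
        V \<in> line_through (graph_point g u) (0, 1) \<inter> cutting_line g u h \<and>
        (let P = graph_point g u; G = centroid (cut_section g a b)
         in G \<in> closed_segment P V \<and> dist P G = 3 / 5 * dist P V)"
    proof eventually_elim
      case (elim h)
      define H where "H = h * sqrt (1 + (deriv g u)\<^sup>2)"
      obtain a b where cut: "cut_abscissae g I u h a b"
        and G: "centroid (cut_section g a b) = (u, g u + 3 / 5 * H)"
        using elim unfolding H_def by blast
      \<comment> \<open>The cutting line is the tangent raised by \<open>H\<close>, so it meets the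
        vertical through \<open>P\<close> at height \<open>H\<close> above \<open>P\<close>.\<close>
      let ?V = "(u, g u + H)"
      have "?V \<in> line_through (graph_point g u) (0, 1) \<inter> cutting_line g u h"
        by (simp add: mem_vertical_line_iff mem_cutting_line_iff H_def)
      moreover have "(u, g u + 3 / 5 * H) \<in> closed_segment (graph_point g u) ?V"
        unfolding closed_segment_def graph_point_def
        by (auto simp: algebra_simps intro!: exI[of _ "3 / 5"])
      moreover have "dist (graph_point g u) (u, g u + 3 / 5 * H) = 3 / 5 * dist (graph_point g u) ?V"
        by (simp add: graph_point_def dist_Pair_Pair dist_real_def abs_mult)
      ultimately show ?case
        using cut by (intro exI[of _ a] exI[of _ b] exI[of _ ?V]) (simp add: G Let_def)
    qed
  qed
  show ?parabola if cen: ?centroids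
  proof -
    have "(deriv ^^ 3) g u = 0" if "u \<in> I" for u
    proof (rule third_deriv_eq_0[OF that])
      \<comment> \<open>\<open>V\<close> lies vertically over \<open>P\<close>, so every point of
        the segment \<open>PV\<close> has abscissa \<open>u\<close>.\<close>
      have "fst (centroid (cut_section g a b)) = u"
        if "V \<in> line_through (graph_point g u) (0, 1)"
          "centroid (cut_section g a b) \<in> closed_segment (graph_point g u) V" for a b V
      proof -
        have "V = (u, snd V)"
          using that(1) mem_vertical_line_iff[of "fst V" "snd V" g u] by (simp add: prod_eq_iff)
        then show ?thesis
          using that(2) fst_eq_if_mem_vertical_segment unfolding graph_point_def by metis
      qed
      then show "\<forall>\<^sub>F h in at_right 0. \<exists>a b. cut_abscissae g I u h a b \<and>
          fst (centroid (cut_section g a b)) = u"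
        using cen[rule_format, OF \<open>u \<in> I\<close>]
        unfolding Let_def by (elim eventually_mono) blast
    qed
    then obtain c p q where "c > 0" and quad: "\<And>x. x \<in> I \<Longrightarrow> g x = c * (x - p)\<^sup>2 + q"
      using quadratic_if_third_deriv_0 \<open>I \<noteq> {}\<close> by blast
    have "open_part_of (graph_on g I) {(x, y). y = c * (x - p)\<^sup>2 + q}"
      using open_part_of_graph[OF open_I interval_I continuous_g refl quad] by simp
    then show ?parabola
      using quadratic_graph_is_parabola[OF \<open>c > 0\<close>, of p q] by blast
  qed
qed

end
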